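(* Let $H$ be a digraph (possibly with loops), $D$ an $H$-colored digraph, and $\mathscr{F}$ a walk-preservative $H$-class partition of $A(D)$ such that for every $F\in\mathscr{F}$, $D\langle F\rangle$ is unilateral and has no sinks. If $C_{\mathscr{F}}(D)$ has a $(k,l)$-kernel for some $k\geq 3$ and $l\geq 1$, then $D$ has a $(k-1,l+1,H)$-kernel by walks.
   Context: An $H$-colored digraph is a finite digraph $D$ without loops with a coloring $\rho:A(D)\to V(H)$. For $F\subseteq A(D)$, $D\langle F\rangle$ is the digraph with arc set $F$ and vertex set the vertices incident with an arc of $F$. An $H$-class partition of $A(D)$ is a partition $\mathscr{F}$ of $A(D)$ such that for all arcs $(u,v),(v,w)$ of $D$, $(\rho(u,v),\rho(v,w))\in A(H)$ iff some $F\in\mathscr{F}$ contains both arcs. The $H$-class digraph $C_{\mathscr{F}}(D)$ has vertex set $\mathscr{F}$, and $(F,G)$ (possibly $F=G$, a loop) is an arc iff there exist $(u,v)\in F$ and $(v,w)\in G$. $\mathscr{F}$ is walk-preservative if for every arc $(F,G)$ of $C_{\mathscr{F}}(D)$ and every $z\in V(D\langle F\rangle)$ there is a $zw$-path in $D\langle F\rangle$ for some $w\in V(D\langle G\rangle)$. A digraph is unilateral if for any two vertices $u,v$ there is a $uv$-path or a $vu$-path; a sink of a loopless digraph is a vertex with no out-going arc. For a digraph $G$ (possibly with loops) and $k\ge2$, $l\ge1$, a $(k,l)$-kernel is a set $S\subseteq V(G)$ such that every walk between two different vertices of $S$ has length at least $k$, and every vertex not in $S$ has a walk of length at most $l$ to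 a vertex of $S$. For a walk $W=(x_0,\ldots,x_n)$ in $D$, there is an obstruction on $x_i$ if $(\rho(x_{i-1},x_i),\rho(x_i,x_{i+1}))\notin A(H)$; for open $W$, $O_H(W)$ is the set of $i\in\{1,\dots,n-1\}$ with an obstruction on $x_i$ and $l_H(W)=|O_H(W)|+1$. A set $S\subseteq V(D)$ is a $(k,l,H)$-kernel by walks if every walk between two different vertices of $S$ has $H$-length at least $k$ and every $x\notin S$ has a walk to $S$ of $H$-length at most $l$. *)

theory Defs
  imports "Graph_Theory.Pair_Digraph" "HOL-Library.Disjoint_Sets"
begin

definition unilateral :: "('a, 'b) pre_digraph \<Rightarrow> bool" where
  "unilateral G \<longleftrightarrow>
    (\<forall>u\<in>verts G. \<forall>v\<in>verts G. \<exists>p. pre_digraph.apath G u p v \<or> pre_digraph.apath G v p u)"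

definition sink :: "('a, 'b) pre_digraph \<Rightarrow> 'a \<Rightarrow> bool" where
  "sink G v \<longleftrightarrow> v \<in> verts G \<and> out_arcs G v = {}"

definition kl_kernel :: "nat \<Rightarrow> nat \<Rightarrow> ('a, 'b) pre_digraph \<Rightarrow> 'a set \<Rightarrow> bool" where
  "kl_kernel k l G S \<longleftrightarrow>
    S \<subseteq> verts G \<and>
    (\<forall>u\<in>S. \<forall>v\<in>S. u \<noteq> v \<longrightarrow> (\<forall>p. pre_digraph.awalk G u p v \<longrightarrow> k \<le> length p)) \<and>
    (\<forall>x\<in>verts G - S. \<exists>s\<in>S. \<exists>p. pre_digraph.awalk G x p s \<and> length p \<le> l)"

text \<open>Only \<open>D\<close> is required to be finite and loopless; \<open>H\<close> may have loops and may be infinite.\<close>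

locale H_colored_digraph =
  H: pair_wf_digraph H + D: pair_digraph D
  for H :: "'c pair_pre_digraph" and D :: "'a pair_pre_digraph" +
  fixes \<rho> :: "'a \<times> 'a \<Rightarrow> 'c"
  assumes coloring: "\<rho> \<in> parcs D \<rightarrow> pverts H"

definition arc_induced :: "('a \<times> 'a) set \<Rightarrow> 'a pair_pre_digraph" where
  "arc_induced F = \<lparr> pverts = fst ` F \<union> snd ` F, parcs = F \<rparr>"

definition H_class_partition ::
    "'c pair_pre_digraph \<Rightarrow> 'a pair_pre_digraph \<Rightarrow> ('a \<times> 'a \<Rightarrow> 'c) \<Rightarrow> ('a \<times> 'a) set set \<Rightarrow> bool" where
  "H_class_partition H D \<rho> \<F> \<longleftrightarrow>
    partition_on (parcs D) \<F> \<and>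
    (\<forall>u v w. (u, v) \<in> parcs D \<and> (v, w) \<in> parcs D \<longrightarrow>
      ((\<rho> (u, v), \<rho> (v, w)) \<in> parcs H \<longleftrightarrow> (\<exists>F\<in>\<F>. (u, v) \<in> F \<and> (v, w) \<in> F)))"

definition class_digraph :: "('a \<times> 'a) set set \<Rightarrow> ('a \<times> 'a) set pair_pre_digraph" where
  "class_digraph \<F> =
    \<lparr> pverts = \<F>,
      parcs = {(F, G). F \<in> \<F> \<and> G \<in> \<F> \<and> (\<exists>u v w. (u, v) \<in> F \<and> (v, w) \<in> G)} \<rparr>"

definition walk_preservative :: "('a \<times> 'a) set set \<Rightarrow> bool" where
  "walk_preservative \<F> \<longleftrightarrow>
    (\<forall>(F, G) \<in> parcs (class_digraph \<F>). \<forall>z\<in>pverts (arc_induced F).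
      \<exists>w\<in>pverts (arc_induced G). \<exists>p. pre_digraph.apath (with_proj (arc_induced F)) z p w)"

text \<open>
  A walk \<open>(x\<^sub>0, \<dots>, x\<^sub>n)\<close> is given by the list \<open>p\<close> of its arcs, so that
  \<open>p ! (i - 1) = (x\<^sub>i\<^sub>-\<^sub>1, x\<^sub>i)\<close> and \<open>p ! i = (x\<^sub>i, x\<^sub>i\<^sub>+\<^sub>1)\<close> for \<open>1 \<le> i \<le> n - 1\<close>.
  These notions are those for open walks and are applied only to walks with distinct end vertices.
\<close>

definition H_obstructions ::
    "'c pair_pre_digraph \<Rightarrow> ('a \<times> 'a \<Rightarrow> 'c) \<Rightarrow> ('a \<times> 'a) awalk \<Rightarrow> nat set" where
  "H_obstructions H \<rho> p =
    {i. 1 \<le> i \<and> i < length p \<and> (\<rho> (p ! (i - 1)), \<rho> (p ! i)) \<notin> parcs H}"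

definition H_length ::
    "'c pair_pre_digraph \<Rightarrow> ('a \<times> 'a \<Rightarrow> 'c) \<Rightarrow> ('a \<times> 'a) awalk \<Rightarrow> nat" where
  "H_length H \<rho> p = card (H_obstructions H \<rho> p) + 1"

definition klH_kernel_by_walks ::
    "nat \<Rightarrow> nat \<Rightarrow> 'c pair_pre_digraph \<Rightarrow> 'a pair_pre_digraph \<Rightarrow> ('a \<times> 'a \<Rightarrow> 'c) \<Rightarrow> 'a set \<Rightarrow> bool" where
  "klH_kernel_by_walks k l H D \<rho> S \<longleftrightarrow>
    S \<subseteq> pverts D \<and>
    (\<forall>u\<in>S. \<forall>v\<in>S. u \<noteq> v \<longrightarrow>
      (\<forall>p. pre_digraph.awalk (with_proj D) u p v \<longrightarrow> k \<le> H_length H \<rho> p)) \<and>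
    (\<forall>x\<in>pverts D - S. \<exists>s\<in>S. \<exists>p.
      pre_digraph.awalk (with_proj D) x p s \<and> H_length H \<rho> p \<le> l)"

end

(* Every class digraph is finite and unilateral, so it has a vertex reachable from all of its
   vertices; having no sinks, this vertex also has an incoming arc of the class.  Choose such a
   vertex for every class of the given kernel and add the isolated vertices of D.  An obstruction
   on a walk of D is exactly a change of class, so a walk between two chosen vertices projects to
   a walk of the class digraph with one arc more than its H-length (the first arc comes from the
   arc entering the initial vertex, the last one from the arc leaving the final vertex).
   Conversely, walk preservation lifts a walk of length j in the class digraph to a walk of D that
   runs through j + 1 classes. *)

theory Submission
  imports Defs
begin

section \<open>H-length of lists of arcs\<close>

lemma H_length_Nil [simp]: "H_length H \<rho> [] = 1"
  by (simp add: H_length_def H_obstructions_def)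

lemma H_length_singleton [simp]: "H_length H \<rho> [e] = 1"
  by (simp add: H_length_def H_obstructions_def)

text \<open>An obstruction at index 1 depends on \<open>e\<close> and \<open>f\<close> alone, and
  the later ones are exactly the obstructions of \<open>f # p\<close> shifted by one. This opens
  \<open>H_length\<close> to induction on the list.\<close>

lemma H_length_Cons_Cons [simp]:
  "H_length H \<rho> (e # f # p) =
    (if (\<rho> e, \<rho> f) \<in> parcs H then 0 else 1) + H_length H \<rho> (f # p)"
proof -
  let ?O = "H_obstructions H \<rho>"
  have "?O (e # f # p) = (if (\<rho> e, \<rho> f) \<in> parcs H then {} else {1}) \<union> Suc ` ?O (f # p)"
    (is "_ = ?R")
  proof (rule set_eqI)
    fix i
    show "i \<in> ?O (e # f # p) \<longleftrightarrow> i \<in> ?R"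
    proof (cases i)
      case (Suc j)
      then show ?thesis
        by (cases j) (auto simp: H_obstructions_def)
    qed (auto simp: H_obstructions_def)
  qed
  moreover have "finite (?O (f # p))" and "1 \<notin> Suc ` ?O (f # p)"
    by (auto simp: H_obstructions_def)
  ultimately show ?thesis
    by (simp add: H_length_def card_image)
qed

text \<open>Concatenation creates at most one new obstruction, at the junction; the right-hand side
  has room for it because both summands contain the additional 1.\<close>

lemma H_length_append_le: "H_length H \<rho> (p @ q) \<le> H_length H \<rho> p + H_length H \<rho> q"
proof (induction p rule: induct_list012)
  case (2 e)
  then show ?case by (cases q) auto
qed auto

section \<open>Chains of arcs and reachability\<close>

text \<open>\<open>cas\<close> sees its digraph only through the projections \<open>fst\<close> and
  \<open>snd\<close>, so \<open>G\<close> is arbitrary. Via \<open>F\<^sup>*\<close>, a path in a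
  class can therefore be read as a walk of \<open>D\<close>.\<close>

lemma rtrancl_if_cas:
  assumes "pre_digraph.cas (with_proj G) u p v" "set p \<subseteq> F"
  shows "(u, v) \<in> F\<^sup>*"
  using assms
  by (induction p arbitrary: u)
     (auto simp: pre_digraph.cas.simps intro: converse_rtrancl_into_rtrancl)

lemma cas_if_rtrancl:
  assumes "(u, v) \<in> F\<^sup>*"
  shows "\<exists>p. set p \<subseteq> F \<and> pre_digraph.cas (with_proj G) u p v"
  using assms
proof (induction rule: converse_rtrancl_induct)
  case base
  have "set [] \<subseteq> F \<and> pre_digraph.cas (with_proj G) v [] v"
    by (simp add: pre_digraph.cas.simps)
  then show ?case by blast
next
  case (step u w)
  then obtain p where "set p \<subseteq> F" "pre_digraph.cas (with_proj G) w p v" by blast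
  with step have "set ((u, w) # p) \<subseteq> F \<and> pre_digraph.cas (with_proj G) u ((u, w) # p) v"
    by (simp add: pre_digraph.cas.simps)
  then show ?case by blast
qed

lemma cas_append:
  assumes "pre_digraph.cas G u p v" "pre_digraph.cas G v q w"
  shows "pre_digraph.cas G u (p @ q) w"
  using assms by (induction p arbitrary: u) (auto simp: pre_digraph.cas.simps)

lemma rtrancl_if_apath:
  assumes "pre_digraph.apath (with_proj (arc_induced F)) u p v"
  shows "(u, v) \<in> F\<^sup>*"
  using assms
  by (intro rtrancl_if_cas)
     (auto simp: pre_digraph.apath_def pre_digraph.awalk_def arc_induced_def)

section \<open>A vertex reached from its whole class\<close>

text \<open>Take \<open>t\<close> reached from as many vertices of \<open>V\<close> as possible. A
  vertex \<open>u\<close> that did not reach \<open>t\<close> would be reached from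
  \<open>t\<close>, hence from everything that reaches \<open>t\<close> and from itself,
  contradicting maximality.\<close>

lemma unilateral_common_target:
  assumes "finite V" "V \<noteq> {}"
    and total: "\<And>u v. u \<in> V \<Longrightarrow> v \<in> V \<Longrightarrow> (u, v) \<in> F\<^sup>* \<or> (v, u) \<in> F\<^sup>*"
  obtains t where "t \<in> V" "\<And>u. u \<in> V \<Longrightarrow> (u, t) \<in> F\<^sup>*"
proof -
  define A where "A v = {u \<in> V. (u, v) \<in> F\<^sup>*}" for v
  have fin: "finite (A v)" for v
    using assms(1) by (simp add: A_def)
  obtain t where t: "t \<in> V" and max: "\<And>v. v \<in> V \<Longrightarrow> card (A v) \<le> card (A t)"
    using assms(1,2) obtains_MAX[of V "\<lambda>v. card (A v)"]
    by (metis Max_ge finite_imageI imageI)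
  have "(u, t) \<in> F\<^sup>*" if u: "u \<in> V" for u
  proof (rule ccontr)
    assume not: "(u, t) \<notin> F\<^sup>*"
    with total[OF u t] have "(t, u) \<in> F\<^sup>*" by blast
    with not u have "A t \<subset> A u"
      by (auto simp: A_def)
    then have "card (A t) < card (A u)"
      using fin psubset_card_mono by blast
    with max[OF u] show False by simp
  qed
  with t show thesis by (rule that)
qed

lemma unilateral_sinkless_target:
  assumes "finite F" "F \<noteq> {}" and loopless: "\<And>v. (v, v) \<notin> F"
    and uni: "unilateral (with_proj (arc_induced F))"
    and sinkless: "\<not> (\<exists>v. sink (with_proj (arc_induced F)) v)"
  obtains t where "t \<in> pverts (arc_induced F)"
    and "\<And>u. u \<in> pverts (arc_induced F) \<Longrightarrow> (u, t) \<in> F\<^sup>*"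
    and "\<exists>u. (u, t) \<in> F" and "\<exists>w. (t, w) \<in> F"
proof -
  let ?V = "pverts (arc_induced F)"
  have "finite ?V" "?V \<noteq> {}"
    using assms(1,2) by (auto simp: arc_induced_def)
  moreover have "(u, v) \<in> F\<^sup>* \<or> (v, u) \<in> F\<^sup>*" if "u \<in> ?V" "v \<in> ?V" for u v
    using uni that by (fastforce simp: unilateral_def dest: rtrancl_if_apath)
  ultimately obtain t where t: "t \<in> ?V" "\<And>u. u \<in> ?V \<Longrightarrow> (u, t) \<in> F\<^sup>*"
    using unilateral_common_target by metis
  have "out_arcs (with_proj (arc_induced F)) t \<noteq> {}"
    using sinkless t(1) by (auto simp: sink_def)
  then obtain w where w: "(t, w) \<in> F"
    by (auto simp: out_arcs_def arc_induced_def)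
  \<comment> \<open>Since \<open>w\<close> differs from \<open>t\<close>, the chain leading from
    \<open>w\<close> back to \<open>t\<close> is nonempty; its last arc enters
    \<open>t\<close>.\<close>
  then have "w \<in> ?V" and "w \<noteq> t"
    using loopless by (force simp: arc_induced_def)+
  then obtain u where "(u, t) \<in> F"
    using t(2)[of w] by (meson rtranclE)
  with t w show thesis using that by blast
qed

section \<open>Projecting walks to the class digraph and lifting them back\<close>

lemma class_digraph_sel [simp]:
  "pverts (class_digraph \<F>) = \<F>"
  "(F, G) \<in> parcs (class_digraph \<F>) \<longleftrightarrow>
    F \<in> \<F> \<and> G \<in> \<F> \<and> (\<exists>u v w. (u, v) \<in> F \<and> (v, w) \<in> G)"
  by (simp_all add: class_digraph_def)

locale class_partitioned =
  fixes H :: "'c pair_pre_digraph"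
    and D :: "'a pair_pre_digraph"
    and \<rho> :: "'a \<times> 'a \<Rightarrow> 'c"
    and \<F> :: "('a \<times> 'a) set set"
  assumes wf: "pair_wf_digraph D"
    and class_partition: "H_class_partition H D \<rho> \<F>"
begin

lemma class_subset: "F \<in> \<F> \<Longrightarrow> F \<subseteq> parcs D"
  using class_partition by (auto simp: H_class_partition_def partition_on_def)

lemma arc_class:
  assumes "e \<in> parcs D"
  obtains F where "F \<in> \<F>" "e \<in> F"
proof -
  have "e \<in> \<Union>\<F>"
    using class_partition assms by (simp add: H_class_partition_def partition_on_def)
  then show thesis
    using that by blast
qed

text \<open>Classes are disjoint, so a class containing both arcs must coincide with
  \<open>F\<close> and with \<open>G\<close>.\<close>

lemma same_class_iff:
  assumes "(u, v) \<in> F" "(v, w) \<in> G" "F \<in> \<F>" "G \<in> \<F>"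
  shows "(\<rho> (u, v), \<rho> (v, w)) \<in> parcs H \<longleftrightarrow> F = G"
proof -
  have "(u, v) \<in> parcs D" "(v, w) \<in> parcs D"
    using class_subset assms by blast+
  then have "(\<rho> (u, v), \<rho> (v, w)) \<in> parcs H \<longleftrightarrow> (\<exists>E\<in>\<F>. (u, v) \<in> E \<and> (v, w) \<in> E)"
    using class_partition by (simp add: H_class_partition_def)
  moreover have "E = E'" if "E \<in> \<F>" "E' \<in> \<F>" "e \<in> E" "e \<in> E'" for E E' e
    using class_partition that
    by (auto simp: H_class_partition_def partition_on_def disjoint_def)
  ultimately show ?thesis
    using assms by metis
qed

lemma H_length_within_class:
  assumes "F \<in> \<F>" "set p \<subseteq> F" "pre_digraph.cas (with_proj D) u p v"
  shows "H_length H \<rho> p = 1"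
  using assms(2,3)
proof (induction p arbitrary: u rule: induct_list012)
  case (3 e f p)
  moreover from 3 have "(\<rho> e, \<rho> f) \<in> parcs H"
    using same_class_iff[of "fst e" "snd e" F "snd f" F] assms(1)
    by (cases e; cases f) (auto simp: pre_digraph.cas.simps)
  ultimately show ?case
    by (auto simp: pre_digraph.cas.simps)
qed auto

text \<open>Record the class of each arc: an obstruction is a change of class and contributes one
  arc of \<open>class_digraph \<F>\<close>, while steps without obstruction contribute nothing. The
  arc \<open>(v, w)\<close> contributes a last arc into \<open>G\<close>, which accounts for the 1
  added in \<open>H_length\<close>.\<close>

lemma project_walk:
  assumes "set (e # p) \<subseteq> parcs D" "pre_digraph.cas (with_proj D) u (e # p) v"
    and "e \<in> E" "E \<in> \<F>" and "(v, w) \<in> G" "G \<in> \<F>"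
  shows "\<exists>q. pre_digraph.awalk (with_proj (class_digraph \<F>)) E q G \<and>
    length q = H_length H \<rho> (e # p)"
  using assms(1-4)
proof (induction p arbitrary: e u E)
  case Nil
  then have "(fst e, v) \<in> E"
    by (cases e) (auto simp: pre_digraph.cas.simps)
  \<comment> \<open>This arc is kept even if \<open>E = G\<close>, when it is a loop; otherwise the
    two lengths would not agree.\<close>
  then have "pre_digraph.awalk (with_proj (class_digraph \<F>)) E [(E, G)] G"
    using assms(5,6) Nil.prems(4)
    by (auto simp: pre_digraph.awalk_def pre_digraph.cas.simps)
  then show ?case by force
next
  case (Cons f p)
  obtain E' where E': "E' \<in> \<F>" "f \<in> E'"
    using Cons.prems(1) arc_class[of f] by auto
  have cas: "pre_digraph.cas (with_proj D) (snd e) (f # p) v" and "fst f = snd e"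
    using Cons.prems(2) by (auto simp: pre_digraph.cas.simps)
  then have consec: "(fst e, snd e) \<in> E" "(snd e, snd f) \<in> E'"
    using Cons.prems(3) E' by (metis prod.collapse)+
  have obstr: "(\<rho> e, \<rho> f) \<in> parcs H \<longleftrightarrow> E = E'"
    using same_class_iff[OF consec Cons.prems(4) E'(1)] \<open>fst f = snd e\<close>
    by (metis prod.collapse)
  obtain q where q: "pre_digraph.awalk (with_proj (class_digraph \<F>)) E' q G"
      "length q = H_length H \<rho> (f # p)"
    using Cons.IH[OF _ cas E'(2,1)] Cons.prems(1) by auto
  show ?case
  proof (cases "E = E'")
    case True
    with q obstr show ?thesis by auto
  next
    case False
    have "(E, E') \<in> parcs (class_digraph \<F>)"
      unfolding class_digraph_sel using Cons.prems(4) E'(1) consec by blast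
    then have "pre_digraph.awalk (with_proj (class_digraph \<F>)) E ((E, E') # q) G"
      using q(1)
      by (auto simp: pre_digraph.awalk_def pre_digraph.cas.simps)
    with q(2) obstr False show ?thesis by force
  qed
qed

text \<open>Arcs of one class cause no obstruction when traversed consecutively. The list may be
  empty if \<open>z = y\<close>, and its \<open>H_length\<close> is 1 as well.\<close>

lemma walk_within_class:
  assumes "F \<in> \<F>" "z \<in> pverts (arc_induced F)" "(z, y) \<in> F\<^sup>*"
  shows "\<exists>p. pre_digraph.awalk (with_proj D) z p y \<and> H_length H \<rho> p = 1"
proof -
  obtain p where p: "set p \<subseteq> F" "pre_digraph.cas (with_proj D) z p y"
    using cas_if_rtrancl[OF assms(3)] by blast
  moreover have "z \<in> pverts D"
    using assms(2) class_subset[OF assms(1)] pair_wf_digraph.in_arcsD1[OF wf]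
      pair_wf_digraph.in_arcsD2[OF wf]
    by (force simp: arc_induced_def)
  moreover have "set p \<subseteq> parcs D"
    using p(1) class_subset[OF assms(1)] by blast
  ultimately show ?thesis
    using H_length_within_class[OF assms(1)] by (auto simp: pre_digraph.awalk_def)
qed

text \<open>For each arc of \<open>q\<close>, walk preservation gives a path inside the current
  class to a vertex of the next one; inside \<open>G\<close>, \<open>target\<close> leads to
  \<open>t\<close>. Each piece has H-length 1, and \<open>H_length_append_le\<close> adds them
  up.\<close>

lemma lift_walk:
  assumes pres: "walk_preservative \<F>"
    and "set q \<subseteq> parcs (class_digraph \<F>)"
    and "pre_digraph.cas (with_proj (class_digraph \<F>)) F q G"
    and "F \<in> \<F>" and "z \<in> pverts (arc_induced F)"
    and target: "\<And>y. y \<in> pverts (arc_induced G) \<Longrightarrow> (y, t) \<in> G\<^sup>*"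
  shows "\<exists>p. pre_digraph.awalk (with_proj D) z p t \<and> H_length H \<rho> p \<le> length q + 1"
  using assms(2-5)
proof (induction q arbitrary: F z)
  case Nil
  then have "F = G"
    by (simp add: pre_digraph.cas.simps)
  then have "(z, t) \<in> F\<^sup>*"
    using Nil.prems(4) target by blast
  then show ?case
    using walk_within_class[OF Nil.prems(3,4)] by force
next
  case (Cons e q)
  obtain E where e: "e = (F, E)"
    using Cons.prems(2) by (cases e) (auto simp: pre_digraph.cas.simps)
  then have arc: "(F, E) \<in> parcs (class_digraph \<F>)"
    and E: "E \<in> \<F>"
    and cas: "pre_digraph.cas (with_proj (class_digraph \<F>)) E q G"
    using Cons.prems(1,2) by (auto simp: pre_digraph.cas.simps)
  obtain y p0 where y: "y \<in> pverts (arc_induced E)"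
      "pre_digraph.apath (with_proj (arc_induced F)) z p0 y"
    using pres arc Cons.prems(4) unfolding walk_preservative_def by blast
  obtain p1 where p1: "pre_digraph.awalk (with_proj D) z p1 y" "H_length H \<rho> p1 = 1"
    using walk_within_class[OF Cons.prems(3,4) rtrancl_if_apath[OF y(2)]] by blast
  obtain p2 where p2: "pre_digraph.awalk (with_proj D) y p2 t"
      "H_length H \<rho> p2 \<le> length q + 1"
    using Cons.IH[OF _ cas E y(1)] Cons.prems(1) by auto
  have "pre_digraph.awalk (with_proj D) z (p1 @ p2) t"
    using p1(1) p2(1) cas_append by (fastforce simp: pre_digraph.awalk_def)
  moreover have "H_length H \<rho> (p1 @ p2) \<le> length (e # q) + 1"
    using H_length_append_le[of H \<rho> p1 p2] p1(2) p2(2) by simp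
  ultimately show ?case by blast
qed

end

section \<open>The kernel by walks: independence and absorption\<close>

theorem theorem7:
  fixes H :: "'c pair_pre_digraph"
    and D :: "'a pair_pre_digraph"
    and \<rho> :: "'a \<times> 'a \<Rightarrow> 'c"
    and \<F> :: "('a \<times> 'a) set set"
    and k l :: nat
  assumes "H_colored_digraph H D \<rho>"
    and "H_class_partition H D \<rho> \<F>"
    and "walk_preservative \<F>"
    and "\<And>F. F \<in> \<F> \<Longrightarrow> unilateral (with_proj (arc_induced F))"
    and "\<And>F. F \<in> \<F> \<Longrightarrow> \<not> (\<exists>v. sink (with_proj (arc_induced F)) v)"
    and "k \<ge> 3" and "l \<ge> 1"
    and "\<exists>S. kl_kernel k l (with_proj (class_digraph \<F>)) S"
  shows "\<exists>N. klH_kernel_by_walks (k - 1) (l + 1) H D \<rho> N"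
proof -
  interpret H_colored_digraph H D \<rho> by fact
  interpret class_partitioned H D \<rho> \<F>
    by (intro class_partitioned.intro D.pair_wf_digraph_axioms assms(2))
  from assms(8) obtain S where kernel: "kl_kernel k l (with_proj (class_digraph \<F>)) S" ..
  have S: "S \<subseteq> \<F>"
    using kernel by (simp add: kl_kernel_def)
  have indep: "k \<le> length q" if "F \<in> S" "G \<in> S" "F \<noteq> G"
    "pre_digraph.awalk (with_proj (class_digraph \<F>)) F q G" for F G q
    using kernel that unfolding kl_kernel_def by simp
  have absorb: "\<exists>G\<in>S. \<exists>q. pre_digraph.awalk (with_proj (class_digraph \<F>)) F q G \<and> length q \<le> l"
    if "F \<in> \<F> - S" for F
    using kernel that unfolding kl_kernel_def by simp
  have "\<exists>t. t \<in> pverts (arc_induced F) \<and> (\<forall>u\<in>pverts (arc_induced F). (u, t) \<in> F\<^sup>*) \<and>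
      (\<exists>u. (u, t) \<in> F) \<and> (\<exists>w. (t, w) \<in> F)" if F: "F \<in> \<F>" for F
  proof -
    have "finite F"
      using class_subset[OF F] D.pair_finite_arcs by (rule finite_subset)
    moreover have "F \<noteq> {}"
      using assms(2) F by (auto simp: H_class_partition_def partition_on_def)
    moreover have "(v, v) \<notin> F" for v
      using class_subset[OF F] D.pair_no_loops[of "(v, v)"] by auto
    ultimately obtain t where "t \<in> pverts (arc_induced F)"
      "\<And>u. u \<in> pverts (arc_induced F) \<Longrightarrow> (u, t) \<in> F\<^sup>*" "\<exists>u. (u, t) \<in> F" "\<exists>w. (t, w) \<in> F"
      by (rule unilateral_sinkless_target[OF _ _ _ assms(4,5)[OF F]]) blast
    then show ?thesis by blast
  qed
  then obtain t where t:
      "\<And>F. F \<in> \<F> \<Longrightarrow> t F \<in> pverts (arc_induced F)"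
      "\<And>F u. F \<in> \<F> \<Longrightarrow> u \<in> pverts (arc_induced F) \<Longrightarrow> (u, t F) \<in> F\<^sup>*"
      "\<And>F. F \<in> \<F> \<Longrightarrow> \<exists>u. (u, t F) \<in> F"
      "\<And>F. F \<in> \<F> \<Longrightarrow> \<exists>w. (t F, w) \<in> F"
    by metis
  \<comment> \<open>Isolated vertices reach no other vertex, so absorption forces them into the
    kernel; no other vertex reaches them, so independence is not affected.\<close>
  define I where "I = {v \<in> pverts D. \<forall>w. (v, w) \<notin> parcs D \<and> (w, v) \<notin> parcs D}"
  have "klH_kernel_by_walks (k - 1) (l + 1) H D \<rho> (t ` S \<union> I)"
    unfolding klH_kernel_by_walks_def
  proof (intro conjI ballI allI impI)
    have "t F \<in> pverts D" if "F \<in> S" for F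
      using t(4)[of F] that S class_subset[of F] D.arc_fst_in_verts by fastforce
    then show "t ` S \<union> I \<subseteq> pverts D"
      by (auto simp: I_def)
  next
    fix u v p
    assume uv: "u \<in> t ` S \<union> I" "v \<in> t ` S \<union> I" "u \<noteq> v"
      and "pre_digraph.awalk (with_proj D) u p v"
    then have p: "set p \<subseteq> parcs D" "pre_digraph.cas (with_proj D) u p v"
      by (auto simp: pre_digraph.awalk_def)
    have "(u, v) \<in> (parcs D)\<^sup>*"
      using rtrancl_if_cas p by metis
    \<comment> \<open>As \<open>u\<close> and \<open>v\<close> differ, some arc leaves
      \<open>u\<close> and some arc enters \<open>v\<close>.\<close>
    then have "u \<notin> I" "v \<notin> I"
      using \<open>u \<noteq> v\<close> by (auto simp: I_def elim: rtranclE converse_rtranclE)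
    then obtain F G where FG: "F \<in> S" "G \<in> S" "u = t F" "v = t G"
      using uv by auto
    obtain e p' where e: "p = e # p'"
      using p(2) \<open>u \<noteq> v\<close> by (cases p) (auto simp: pre_digraph.cas.simps)
    then obtain E where E: "E \<in> \<F>" "e \<in> E"
      using p(1) arc_class[of e] by auto
    \<comment> \<open>The last arc of \<open>p\<close> may lie in another class than
      \<open>G\<close>; an arc of \<open>G\<close> leaving \<open>v\<close> makes the projection end
      in \<open>G\<close> nevertheless.\<close>
    obtain w where w: "(v, w) \<in> G"
      using t(4) FG S by blast
    obtain q where q: "pre_digraph.awalk (with_proj (class_digraph \<F>)) E q G"
        "length q = H_length H \<rho> p"
      using project_walk[of e p' u v E w G] p e E w FG S by blast
    \<comment> \<open>Likewise the first arc of \<open>p\<close> may lie outside \<open>F\<close>.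
      The arc of \<open>F\<close> entering \<open>u\<close> yields \<open>(F, E)\<close>, possibly a
      loop; this one additional arc turns the bound \<open>k\<close> into
      \<open>k - 1\<close>.\<close>
    obtain y where "(y, u) \<in> F"
      using t(3) FG S by blast
    moreover have "(u, snd e) \<in> E"
      using p(2) e E by (auto simp: pre_digraph.cas.simps)
    ultimately have "pre_digraph.awalk (with_proj (class_digraph \<F>)) F ((F, E) # q) G"
      using q(1) E(1) FG(1) S by (auto simp: pre_digraph.awalk_def pre_digraph.cas.simps)
    moreover have "F \<noteq> G"
      using \<open>u \<noteq> v\<close> FG(3,4) by blast
    ultimately have "k \<le> length ((F, E) # q)"
      using indep FG(1,2) by blast
    with q(2) show "k - 1 \<le> H_length H \<rho> p" by simp
  next
    fix x
    assume x: "x \<in> pverts D - (t ` S \<union> I)"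
    then obtain a where a: "a \<in> parcs D" "x = fst a \<or> x = snd a"
      by (auto simp: I_def)
    then obtain F where F: "F \<in> \<F>" "a \<in> F"
      using arc_class by blast
    with a(2) have xF: "x \<in> pverts (arc_induced F)"
      by (auto simp: arc_induced_def)
    \<comment> \<open>If \<open>F\<close> is already in \<open>S\<close>, the empty walk serves:
      \<open>x\<close> then reaches \<open>t F\<close> inside \<open>F\<close>.\<close>
    obtain G q where G: "G \<in> S" and q: "length q \<le> l"
        "pre_digraph.awalk (with_proj (class_digraph \<F>)) F q G"
    proof (cases "F \<in> S")
      case True
      moreover have "pre_digraph.awalk (with_proj (class_digraph \<F>)) F [] F"
        using F(1) by (simp add: pre_digraph.awalk_def pre_digraph.cas.simps)
      ultimately show thesis
        using that[of F "[]"] by simp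
    next
      case False
      then show thesis
        using absorb[of F] F(1) that by blast
    qed
    have "set q \<subseteq> parcs (class_digraph \<F>)"
      and "pre_digraph.cas (with_proj (class_digraph \<F>)) F q G"
      using q(2) by (auto simp: pre_digraph.awalk_def)
    moreover have "(y, t G) \<in> G\<^sup>*" if "y \<in> pverts (arc_induced G)" for y
      using t(2) that G S by blast
    ultimately obtain p where "pre_digraph.awalk (with_proj D) x p (t G)"
        "H_length H \<rho> p \<le> length q + 1"
      using lift_walk[OF assms(3) _ _ F(1) xF] by blast
    moreover have "length q + 1 \<le> l + 1"
      using q(1) by simp
    ultimately show "\<exists>s\<in>t ` S \<union> I. \<exists>p. pre_digraph.awalk (with_proj D) x p s \<and>
        H_length H \<rho> p \<le> l + 1"
      using G le_trans by blast
  qed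
  then show ?thesis by blast
qed

end
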